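(* Let $d\ge 1$, let $\mathcal{A}\in\mathbb{R}^{n_1\times\dots\times n_d}$ be a real tensor, and let $r_k,\ell_k$ be integers with $1\le r_k\le n_k$ and $\ell_k\ge 0$ for $k=1,\dots,d$. For each $k=1,\dots,d$ let $$X_k\in\mathbb{R}^{\left(\prod_{i<k}(r_i+\ell_i)\prod_{i>k}n_i\right)\times r_k},\qquad Y_k\in\mathbb{R}^{n_k\times(r_k+\ell_k)}$$ be matrices (the realizations of the sketching matrices drawn by the algorithm), and let $\widehat{\mathcal{A}}$ be the corresponding sequential multilinear Nyström (SMLN) approximant of $\mathcal{A}$. Assume that for each $k=1,\dots,d$ the $(r_k+\ell_k)\times r_k$ matrix $Y_k^T\mathcal{A}_k(I\otimes Y_{\otimes_{<k}})X_k$ has full column rank. For each $k$ let $Q_kR_k=\mathcal{A}_k(I\otimes Y_{\otimes_{<k}})X_k$ be an economy-size QR factorization, with $Q_k\in\mathbb{R}^{n_k\times r_k}$ having orthonormal columns and $R_k\in\mathbb{R}^{r_k\times r_k}$ upper triangular, and let $Q_{k\perp}\in\mathbb{R}^{n_k\times(n_k-r_k)}$ be a matrix whose columns form an orthonormal basis of the orthogonal complement of the range of $Q_k$. Then $$\|\mathcal{A}-\widehat{\mathcal{A}}\|_F\le\sum_{k=1}^d\left\|Q_{k\perp}^T\mathcal{A}_k(I\otimes Y_{\otimes_{<k}})\right\|_F\,\left\|I-Q_k(Y_k^TQ_k)^\dagger Y_k^T\right\|_2\,\prod_{i=1}^{k-1}\left\|(Y_i^TQ_i)^\dagger\right\|_2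 .$$
   Context: Notation. $\|\cdot\|_F$ is the Frobenius norm (of a tensor: the square root of the sum of squares of its entries), $\|\cdot\|_2$ the spectral norm, $\dagger$ the Moore–Penrose inverse, $\otimes$ the Kronecker product, and $I$ an identity matrix of the size required by the context. Empty products of numbers equal $1$, and the Frobenius norm of an empty matrix (the case $r_k=n_k$) is $0$. For a tensor $\mathcal{A}\in\mathbb{R}^{n_1\times\dots\times n_d}$, the mode-$k$ matricization $\mathcal{A}_k$ is the $n_k\times\prod_{i\ne k}n_i$ matrix whose rows are indexed by the $k$-th index and whose columns are indexed by the remaining indices (ordered with lower-numbered indices varying fastest). The mode-$k$ product $\mathcal{A}\times_k X$ with $X\in\mathbb{R}^{m\times n_k}$ is the tensor obtained by replacing the $k$-th dimension $n_k$ by $m$, characterized by $(\mathcal{A}\times_kX)_k=X\mathcal{A}_k$. Writing $\mathcal{A}\times_{k=1}^dX_k:=\mathcal{A}\times_1X_1\times_2\cdots\times_dX_d$, one has the convention-fixing identity $$(\mathcal{A}\times_1X_1\cdots\times_dX_d)_k=X_k\mathcal{A}_k(X_d\otimes\dots\otimes X_{k+1}\otimes X_{k-1}\otimes\dots\otimes X_1)^T .$$ $Y_{\otimes_{<k}}:=Y_{k-1}\otimes\dots\otimes Y_1$ (equal to the $1\times1$ matrix $1$ when $k=1$). In $\mathcal{A}_k(I\otimes Y_{\otimes_{<k}})$ the identity $I$ has size $\prod_{i>k}n_i$ (equal to $1$ when $k=d$), so $\mathcal{A}_k(I\otimes Y_{\otimes_{<k}})$ is the $n_k\times\left(\prod_{i<k}(r_i+\ell_i)\prod_{i>k}n_i\right)$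 mode-$k$ matricization of $\mathcal{A}\times_{i=1}^{k-1}Y_i^T$. The SMLN approximant of $\mathcal{A}$ (all modes processed, in the order $1,\dots,d$) is $$\widehat{\mathcal{A}}:=\mathcal{A}\times_{k=1}^dP_k,\qquad P_k:=\mathcal{A}_k(I\otimes Y_{\otimes_{<k}})X_k\left(Y_k^T\mathcal{A}_k(I\otimes Y_{\otimes_{<k}})X_k\right)^\dagger Y_k^T ,$$ equivalently $$\widehat{\mathcal{A}}=\left(\mathcal{A}\times_{k=1}^dY_k^T\right)\times_{k=1}^d\left[\mathcal{A}_k(I\otimes Y_{\otimes_{<k}})X_k\left(Y_k^T\mathcal{A}_k(I\otimes Y_{\otimes_{<k}})X_k\right)^\dagger\right].$$ This is the tensor output by the SMLN algorithm with inputs $\mathcal{A}$, multilinear rank $(r_1,\dots,r_d)$, oversampling $(\ell_1,\dots,\ell_d)$ and sketching matrices $X_k,Y_k$. *)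

theory Defs
  imports Complex_Main "Jordan_Normal_Form.DL_Rank"
begin

subsection \<open>Matrices\<close>

definition vec_norm2 :: "real vec \<Rightarrow> real" where
  "vec_norm2 v = sqrt (v \<bullet> v)"

definition frob_norm :: "real mat \<Rightarrow> real" where
  "frob_norm M = sqrt (\<Sum>i<dim_row M. \<Sum>j<dim_col M. (M $$ (i,j))\<^sup>2)"

text \<open>The supremum is over the closed unit ball rather than the unit sphere so that the set is
  nonempty also for matrices without columns.\<close>

definition spectral_norm :: "real mat \<Rightarrow> real" where
  "spectral_norm M = (SUP v \<in> {v \<in> carrier_vec (dim_col M). vec_norm2 v \<le> 1}. vec_norm2 (M *\<^sub>v v))"

definition is_pseudo_inverse :: "real mat \<Rightarrow> real mat \<Rightarrow> bool" where
  "is_pseudo_inverse M X \<longleftrightarrow>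
     X \<in> carrier_mat (dim_col M) (dim_row M) \<and>
     M * X * M = M \<and> X * M * X = X \<and>
     (M * X)\<^sup>T = M * X \<and> (X * M)\<^sup>T = X * M"

definition pseudo_inverse :: "real mat \<Rightarrow> real mat" where
  "pseudo_inverse M = (THE X. is_pseudo_inverse M X)"

lemma is_pseudo_inverse_unique:
  assumes X: "is_pseudo_inverse M X" and Y: "is_pseudo_inverse M Y"
  shows "X = Y"
proof -
  have assoc: "A * B * C = A * (B * C)"
    if "dim_col A = dim_row B" "dim_col B = dim_row C" for A B C :: "real mat"
    using that by (intro assoc_mult_mat[of A "dim_row A" "dim_row B" B "dim_row C"]) auto
  have trans: "(A * B)\<^sup>T = B\<^sup>T * A\<^sup>T" if "dim_col A = dim_row B" for A B :: "real mat"
    using that by (intro transpose_mult[of A "dim_row A" "dim_row B" B]) auto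
  have dims: "dim_row X = dim_col M" "dim_col X = dim_row M"
    "dim_row Y = dim_col M" "dim_col Y = dim_row M"
    using X Y by (auto simp: is_pseudo_inverse_def)
  note X' = X[unfolded is_pseudo_inverse_def] and Y' = Y[unfolded is_pseudo_inverse_def]
  have "M * X = (M * Y) * (M * X)"
    using Y' dims by (metis assoc index_mult_mat(2,3))
  also have "\<dots> = (M * Y)\<^sup>T * (M * X)\<^sup>T" using X' Y' by simp
  also have "\<dots> = ((M * X) * (M * Y))\<^sup>T" using dims by (simp add: trans[of "M * X" "M * Y"])
  also have "(M * X) * (M * Y) = M * Y"
    using X' dims by (metis assoc index_mult_mat(2,3))
  also have "(M * Y)\<^sup>T = M * Y" using Y' by simp
  finally have 1: "M * X = M * Y" .
  have "X * M = (X * M) * (Y * M)"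
    using Y' dims by (metis assoc index_mult_mat(2,3))
  also have "\<dots> = (X * M)\<^sup>T * (Y * M)\<^sup>T" using X' Y' by simp
  also have "\<dots> = ((Y * M) * (X * M))\<^sup>T" using dims by (simp add: trans[of "Y * M" "X * M"])
  also have "(Y * M) * (X * M) = Y * M"
    using X' dims by (metis assoc index_mult_mat(2,3))
  also have "(Y * M)\<^sup>T = Y * M" using Y' by simp
  finally have 2: "X * M = Y * M" .
  have "X = X * M * X" using X' by simp
  also have "\<dots> = Y * M * X" using 2 by simp
  also have "\<dots> = Y * (M * Y)" using 1 dims by (simp add: assoc)
  also have "\<dots> = Y * M * Y" using dims by (simp add: assoc)
  also have "\<dots> = Y" using Y' by simp
  finally show ?thesis .
qed

corollary pseudo_inverse_eqI: "is_pseudo_inverse M X \<Longrightarrow> pseudo_inverse M = X"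
  unfolding pseudo_inverse_def using is_pseudo_inverse_unique by blast

definition kronecker :: "real mat \<Rightarrow> real mat \<Rightarrow> real mat" where
  "kronecker M N = mat (dim_row M * dim_row N) (dim_col M * dim_col N)
     (\<lambda>(i,j). M $$ (i div dim_row N, j div dim_col N) * N $$ (i mod dim_row N, j mod dim_col N))"

text \<open>Modes are numbered from \<open>0\<close>, so \<open>kron_below Y k\<close> is the Kronecker product of
  \<open>Y (k - 1), \<dots>, Y 0\<close> in this order.\<close>

primrec kron_below :: "(nat \<Rightarrow> real mat) \<Rightarrow> nat \<Rightarrow> real mat" where
  "kron_below Y 0 = 1\<^sub>m 1"
| "kron_below Y (Suc k) = kronecker (Y k) (kron_below Y k)"

definition orthonormal_cols :: "real mat \<Rightarrow> bool" where
  "orthonormal_cols Q \<longleftrightarrow> Q\<^sup>T * Q = 1\<^sub>m (dim_col Q)"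

definition full_col_rank :: "real mat \<Rightarrow> bool" where
  "full_col_rank M \<longleftrightarrow> vec_space.rank (dim_row M) M = dim_col M"

text \<open>For a matrix \<open>B\<close> with orthonormal (hence linearly independent) columns, these are a basis of
  a subspace iff the column space of \<open>B\<close> is that subspace.\<close>

definition orthonormal_basis_of_complement :: "real mat \<Rightarrow> real mat \<Rightarrow> bool" where
  "orthonormal_basis_of_complement B Q \<longleftrightarrow>
     orthonormal_cols B \<and>
     vec_space.col_space (dim_row B) B =
       vec_module.orthogonal_complement (dim_row Q) (vec_space.col_space (dim_row Q) Q)"

subsection \<open>Tensors\<close>

text \<open>A tensor consists of its order \<open>d\<close>, its dimensions, of which only those of the modes
  \<open>0, \<dots>, d - 1\<close> are meaningful, and its entries, of which only those at the indices in
  \<open>tensor_indices\<close> are meaningful. All sums below are over meaningful entries only.\<close>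

datatype tensor =
  Tensor (tensor_order: nat) (tensor_dim: "nat \<Rightarrow> nat") (tensor_entry: "(nat \<Rightarrow> nat) \<Rightarrow> real")

definition tensor_indices :: "tensor \<Rightarrow> (nat \<Rightarrow> nat) set" where
  "tensor_indices T = (\<Pi>\<^sub>E i \<in> {..<tensor_order T}. {..<tensor_dim T i})"

definition tensor_diff :: "tensor \<Rightarrow> tensor \<Rightarrow> tensor" where
  "tensor_diff S T = Tensor (tensor_order S) (tensor_dim S) (\<lambda>I. tensor_entry S I - tensor_entry T I)"

definition tensor_norm :: "tensor \<Rightarrow> real" where
  "tensor_norm T = sqrt (\<Sum>I \<in> tensor_indices T. (tensor_entry T I)\<^sup>2)"

text \<open>The index of the entry in row \<open>a\<close> and column \<open>c\<close> of the mode-\<open>k\<close> matricization: \<open>c\<close> is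
  expanded in the mixed radix given by the dimensions other than the \<open>k\<close>-th one, where the digit of
  the lowest mode is the least significant one.\<close>

definition matricize_index :: "tensor \<Rightarrow> nat \<Rightarrow> nat \<Rightarrow> nat \<Rightarrow> nat \<Rightarrow> nat" where
  "matricize_index T k a c =
     (\<lambda>i \<in> {..<tensor_order T}.
        if i = k then a else (c div (\<Prod>m \<in> {..<i} - {k}. tensor_dim T m)) mod tensor_dim T i)"

definition matricize :: "tensor \<Rightarrow> nat \<Rightarrow> real mat" where
  "matricize T k =
     mat (tensor_dim T k) (\<Prod>i \<in> {..<tensor_order T} - {k}. tensor_dim T i)
       (\<lambda>(a,c). tensor_entry T (matricize_index T k a c))"

definition mode_product :: "tensor \<Rightarrow> nat \<Rightarrow> real mat \<Rightarrow> tensor" where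
  "mode_product T k X =
     Tensor (tensor_order T) ((tensor_dim T)(k := dim_row X))
       (\<lambda>I. \<Sum>j<tensor_dim T k. X $$ (I k, j) * tensor_entry T (I(k := j)))"

lemma matricize_mode_product:
  assumes "k < tensor_order T" "dim_col X = tensor_dim T k"
  shows "matricize (mode_product T k X) k = X * matricize T k"
proof (rule eq_matI)
  fix a c assume "a < dim_row (X * matricize T k)" "c < dim_col (X * matricize T k)"
  then have a: "a < dim_row X" and c: "c < (\<Prod>i \<in> {..<tensor_order T} - {k}. tensor_dim T i)"
    by (simp_all add: matricize_def)
  have idx: "(matricize_index (mode_product T k X) k a c)(k := j) = matricize_index T k j c" for j
    using assms(1) by (auto simp: matricize_index_def mode_product_def fun_eq_iff restrict_def
        intro!: arg_cong2[where f = "(mod)"] arg_cong2[where f = "(div)"] prod.cong)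
  have idxk: "matricize_index (mode_product T k X) k a c k = a"
    using assms(1) by (simp add: matricize_index_def mode_product_def)
  have ent: "tensor_entry (mode_product T k X) I =
      (\<Sum>j<tensor_dim T k. X $$ (I k, j) * tensor_entry T (I(k := j)))" for I
    by (simp add: mode_product_def)
  have cols: "(\<Prod>i\<in>{..<tensor_order T} - {k}. if i = k then dim_row X else tensor_dim T i)
      = (\<Prod>i\<in>{..<tensor_order T} - {k}. tensor_dim T i)"
    by (rule prod.cong) auto
  have dims: "tensor_dim (mode_product T k X) k = dim_row X"
    "(\<Prod>i \<in> {..<tensor_order (mode_product T k X)} - {k}. tensor_dim (mode_product T k X) i)
      = (\<Prod>i \<in> {..<tensor_order T} - {k}. tensor_dim T i)"
    using cols by (simp_all add: mode_product_def)
  have "matricize (mode_product T k X) k $$ (a, c)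
      = tensor_entry (mode_product T k X) (matricize_index (mode_product T k X) k a c)"
    using a c unfolding matricize_def dims by simp
  also have "\<dots> = (\<Sum>j<tensor_dim T k. X $$ (a, j) * tensor_entry T (matricize_index T k j c))"
    unfolding ent idx idxk ..
  also have "\<dots> = (X * matricize T k) $$ (a, c)"
    using a c assms(2) by (auto simp: scalar_prod_def matricize_def atLeast0LessThan intro!: sum.cong)
  finally show "matricize (mode_product T k X) k $$ (a, c) = (X * matricize T k) $$ (a, c)" .
next
  show "dim_row (matricize (mode_product T k X) k) = dim_row (X * matricize T k)"
    by (simp add: matricize_def mode_product_def)
  show "dim_col (matricize (mode_product T k X) k) = dim_col (X * matricize T k)"
    by (auto simp: matricize_def mode_product_def intro!: prod.cong)
qed

definition multi_mode_product :: "tensor \<Rightarrow> (nat \<Rightarrow> real mat) \<Rightarrow> tensor" where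
  "multi_mode_product T P = fold (\<lambda>k S. mode_product S k (P k)) [0..<tensor_order T] T"

subsection \<open>The sequential multilinear Nystrom approximant\<close>

definition smln_unfolding :: "tensor \<Rightarrow> (nat \<Rightarrow> real mat) \<Rightarrow> nat \<Rightarrow> real mat" where
  "smln_unfolding A Y k =
     matricize A k * kronecker (1\<^sub>m (\<Prod>i \<in> {k<..<tensor_order A}. tensor_dim A i)) (kron_below Y k)"

definition smln_projector ::
  "tensor \<Rightarrow> (nat \<Rightarrow> real mat) \<Rightarrow> (nat \<Rightarrow> real mat) \<Rightarrow> nat \<Rightarrow> real mat" where
  "smln_projector A X Y k =
     smln_unfolding A Y k * X k * pseudo_inverse ((Y k)\<^sup>T * smln_unfolding A Y k * X k) * (Y k)\<^sup>T"

definition smln :: "tensor \<Rightarrow> (nat \<Rightarrow> real mat) \<Rightarrow> (nat \<Rightarrow> real mat) \<Rightarrow> tensor" where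
  "smln A X Y = multi_mode_product A (smln_projector A X Y)"

end

theory Submission
  imports Defs "HOL-Analysis.L2_Norm"
begin

text \<open>Since \<open>Q k * R k\<close> is the sketch \<open>smln_unfolding A Y k * X k\<close> and \<open>R k\<close> is invertible by
  the rank hypothesis, the factors \<open>R k\<close> cancel and the \<open>k\<close>-th projector is
  \<open>P k = Q k * C k * (Y k)\<^sup>T\<close> with \<open>C k\<close> the pseudoinverse of \<open>(Y k)\<^sup>T * Q k\<close>. The error telescopes
  into the terms \<open>A \<times>\<^sub>i\<^sub><\<^sub>k P i \<times>\<^sub>k (I - P k)\<close>. As products along different modes commute, the factors
  \<open>Q i * C i\<close> with \<open>i < k\<close> can be split off at the cost of their spectral norms, which are at most those
  of \<open>C i\<close>; what remains is the Frobenius norm of \<open>(I - P k) * smln_unfolding A Y k\<close>. Finally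
  \<open>P k * Q k = Q k\<close>, so \<open>I - P k = (I - P k) * Qp k * (Qp k)\<^sup>T\<close>.\<close>

subsection \<open>Vector and matrix norms\<close>

lemma vec_norm2_eq_L2_set: "vec_norm2 v = L2_set (\<lambda>i. v $ i) {..<dim_vec v}"
  by (simp add: vec_norm2_def L2_set_def scalar_prod_def power2_eq_square atLeast0LessThan)

lemma vec_norm2_nonneg [simp]: "0 \<le> vec_norm2 v"
  by (simp add: vec_norm2_eq_L2_set)

lemma vec_norm2_square: "(vec_norm2 v)\<^sup>2 = (\<Sum>i<dim_vec v. (v $ i)\<^sup>2)"
  by (simp add: vec_norm2_eq_L2_set L2_set_def sum_nonneg)

lemma vec_norm2_smult: "vec_norm2 (c \<cdot>\<^sub>v v) = \<bar>c\<bar> * vec_norm2 v"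
proof -
  have "(vec_norm2 (c \<cdot>\<^sub>v v))\<^sup>2 = (\<bar>c\<bar> * vec_norm2 v)\<^sup>2"
    by (simp add: vec_norm2_square power_mult_distrib sum_distrib_left)
  then show ?thesis by (simp add: power2_eq_iff_nonneg)
qed

lemma vec_norm2_eq_0_iff:
  assumes "v \<in> carrier_vec n"
  shows "vec_norm2 v = 0 \<longleftrightarrow> v = 0\<^sub>v n"
  using assms by (auto simp: vec_norm2_eq_L2_set L2_set_eq_0_iff)

lemma vec_norm2_zero [simp]: "vec_norm2 (0\<^sub>v n) = 0"
  by (simp add: vec_norm2_eq_0_iff[of _ n])

lemma scalar_prod_le_vec_norm2:
  assumes "dim_vec v = dim_vec w"
  shows "\<bar>v \<bullet> w\<bar> \<le> vec_norm2 v * vec_norm2 w"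
proof -
  have "\<bar>v \<bullet> w\<bar> \<le> (\<Sum>i<dim_vec w. \<bar>v $ i\<bar> * \<bar>w $ i\<bar>)"
    unfolding scalar_prod_def atLeast0LessThan abs_mult[symmetric] by (rule sum_abs)
  also have "\<dots> \<le> vec_norm2 v * vec_norm2 w"
    unfolding vec_norm2_eq_L2_set assms by (rule L2_set_mult_ineq)
  finally show ?thesis .
qed

section \<open>Frobenius and spectral norms\<close>

lemma frob_norm_nonneg [simp]: "0 \<le> frob_norm M"
  by (simp add: frob_norm_def sum_nonneg)

lemma frob_norm_square_rows: "(frob_norm M)\<^sup>2 = (\<Sum>i<dim_row M. (vec_norm2 (row M i))\<^sup>2)"
  by (simp add: frob_norm_def sum_nonneg vec_norm2_square)

lemma frob_norm_square_cols: "(frob_norm M)\<^sup>2 = (\<Sum>j<dim_col M. (vec_norm2 (col M j))\<^sup>2)"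
  unfolding frob_norm_def vec_norm2_square by (subst sum.swap) (simp add: sum_nonneg)

text \<open>Cauchy-Schwarz in each row. This crude bound makes the supremum defining
  \<open>spectral_norm\<close> finite, so that it is an upper bound at all.\<close>

lemma vec_norm2_mult_mat_vec_le_frob:
  assumes "v \<in> carrier_vec (dim_col M)"
  shows "vec_norm2 (M *\<^sub>v v) \<le> frob_norm M * vec_norm2 v"
proof (rule power2_le_imp_le)
  have "(vec_norm2 (M *\<^sub>v v))\<^sup>2 = (\<Sum>i<dim_row M. \<bar>row M i \<bullet> v\<bar>\<^sup>2)"
    by (simp add: vec_norm2_square)
  also have "\<dots> \<le> (\<Sum>i<dim_row M. (vec_norm2 (row M i) * vec_norm2 v)\<^sup>2)"
    using assms by (intro sum_mono power_mono scalar_prod_le_vec_norm2) auto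
  also have "\<dots> = (frob_norm M * vec_norm2 v)\<^sup>2"
    by (simp add: power_mult_distrib frob_norm_square_rows sum_distrib_right)
  finally show "(vec_norm2 (M *\<^sub>v v))\<^sup>2 \<le> (frob_norm M * vec_norm2 v)\<^sup>2" .
qed simp

lemma spectral_norm_bdd_above:
  "bdd_above ((\<lambda>v. vec_norm2 (M *\<^sub>v v)) ` {v \<in> carrier_vec (dim_col M). vec_norm2 v \<le> 1})"
proof (rule bdd_aboveI2[of _ _ "frob_norm M"])
  fix v assume "v \<in> {v \<in> carrier_vec (dim_col M). vec_norm2 v \<le> 1}"
  then show "vec_norm2 (M *\<^sub>v v) \<le> frob_norm M"
    using vec_norm2_mult_mat_vec_le_frob[of v M] mult_left_mono[of "vec_norm2 v" 1 "frob_norm M"]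
    by auto
qed

lemma vec_norm2_mult_le_spectral_norm:
  assumes "v \<in> carrier_vec (dim_col M)" "vec_norm2 v \<le> 1"
  shows "vec_norm2 (M *\<^sub>v v) \<le> spectral_norm M"
  unfolding spectral_norm_def using assms by (intro cSUP_upper spectral_norm_bdd_above) auto

lemma spectral_norm_nonneg [simp]: "0 \<le> spectral_norm M"
proof -
  have "vec_norm2 (M *\<^sub>v 0\<^sub>v (dim_col M)) \<le> spectral_norm M"
    by (intro vec_norm2_mult_le_spectral_norm) auto
  then show ?thesis using vec_norm2_nonneg order_trans by blast
qed

text \<open>By homogeneity, a nonzero vector is scaled to norm \<open>1\<close>, where the supremum
  applies. A vector of norm \<open>0\<close> cannot be scaled and is covered by the Frobenius
  bound.\<close>

lemma spectral_norm_bound: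
  assumes v: "v \<in> carrier_vec (dim_col M)"
  shows "vec_norm2 (M *\<^sub>v v) \<le> spectral_norm M * vec_norm2 v"
proof (cases "vec_norm2 v = 0")
  case True
  then have "vec_norm2 (M *\<^sub>v v) \<le> 0"
    using vec_norm2_mult_mat_vec_le_frob[OF v] by simp
  then show ?thesis using True by simp
next
  case False
  define c where "c = vec_norm2 v"
  have c: "c > 0" using False by (simp add: c_def less_le)
  have "vec_norm2 (M *\<^sub>v ((1 / c) \<cdot>\<^sub>v v)) \<le> spectral_norm M"
    using v c by (intro vec_norm2_mult_le_spectral_norm) (simp_all add: vec_norm2_smult flip: c_def)
  also have "M *\<^sub>v ((1 / c) \<cdot>\<^sub>v v) = (1 / c) \<cdot>\<^sub>v (M *\<^sub>v v)"
    using v by (intro mult_mat_vec[of _ "dim_row M" "dim_col M"]) auto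
  finally show ?thesis using c by (simp add: vec_norm2_smult field_simps flip: c_def)
qed

text \<open>Bounding a real supremum from above requires a nonempty set; the zero vector lies in the
  unit ball even when \<open>M\<close> has no columns.\<close>

lemma spectral_norm_leI:
  assumes "\<And>v. v \<in> carrier_vec (dim_col M) \<Longrightarrow> vec_norm2 v \<le> 1 \<Longrightarrow> vec_norm2 (M *\<^sub>v v) \<le> c"
  shows "spectral_norm M \<le> c"
proof -
  have "0\<^sub>v (dim_col M) \<in> {v \<in> carrier_vec (dim_col M). vec_norm2 v \<le> 1}" by simp
  then show ?thesis unfolding spectral_norm_def using assms by (intro cSUP_least) blast+
qed

text \<open>Squared Frobenius norms add up over columns, and \<open>Z\<close> stretches each column
  of \<open>M\<close> by at most its spectral norm.\<close>

lemma frob_norm_mult_le: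
  assumes "dim_col Z = dim_row M"
  shows "frob_norm (Z * M) \<le> spectral_norm Z * frob_norm M"
proof (rule power2_le_imp_le)
  have col: "col (Z * M) j = Z *\<^sub>v col M j" if "j < dim_col M" for j
    using assms that by (intro col_mult2[of _ "dim_row Z" "dim_col Z" _ "dim_col M"]) auto
  have "(frob_norm (Z * M))\<^sup>2 = (\<Sum>j<dim_col M. (vec_norm2 (Z *\<^sub>v col M j))\<^sup>2)"
    unfolding frob_norm_square_cols by (simp add: col)
  also have "\<dots> \<le> (\<Sum>j<dim_col M. (spectral_norm Z * vec_norm2 (col M j))\<^sup>2)"
    using assms by (intro sum_mono power_mono spectral_norm_bound) (auto intro: carrier_vecI)
  also have "\<dots> = (spectral_norm Z * frob_norm M)\<^sup>2"
    by (simp add: power_mult_distrib frob_norm_square_cols sum_distrib_left)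
  finally show "(frob_norm (Z * M))\<^sup>2 \<le> (spectral_norm Z * frob_norm M)\<^sup>2" .
qed simp

lemma scalar_prod_mult_mat_vec_self:
  fixes M :: "real mat"
  assumes M: "M \<in> carrier_mat m n" and v: "v \<in> carrier_vec n"
  shows "(M *\<^sub>v v) \<bullet> (M *\<^sub>v v) = v \<bullet> ((M\<^sup>T * M) *\<^sub>v v)"
proof -
  have Mv: "M *\<^sub>v v \<in> carrier_vec m" and MT: "M\<^sup>T \<in> carrier_mat n m" using M v by auto
  have "v \<bullet> ((M\<^sup>T * M) *\<^sub>v v) = v \<bullet> (M\<^sup>T *\<^sub>v (M *\<^sub>v v))"
    using assoc_mult_mat_vec[OF MT M v] by simp
  also have "\<dots> = (M\<^sup>T *\<^sub>v (M *\<^sub>v v)) \<bullet> v"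
    using MT Mv v by (intro comm_scalar_prod[of _ n]) auto
  also have "\<dots> = (M *\<^sub>v v) \<bullet> (M *\<^sub>v v)"
    by (rule transpose_vec_mult_scalar[OF M v Mv])
  finally show ?thesis by simp
qed

section \<open>Matrices with orthonormal columns as isometries\<close>

lemma vec_norm2_orthonormal_mult:
  assumes "orthonormal_cols Q" "v \<in> carrier_vec (dim_col Q)"
  shows "vec_norm2 (Q *\<^sub>v v) = vec_norm2 v"
proof -
  have "(Q *\<^sub>v v) \<bullet> (Q *\<^sub>v v) = v \<bullet> ((Q\<^sup>T * Q) *\<^sub>v v)"
    using assms(2) by (intro scalar_prod_mult_mat_vec_self) auto
  also have "\<dots> = v \<bullet> v" using assms by (simp add: orthonormal_cols_def)
  finally show ?thesis by (simp add: vec_norm2_def)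
qed

lemma frob_norm_orthonormal_mult:
  assumes "orthonormal_cols Q" "dim_col Q = dim_row M"
  shows "frob_norm (Q * M) = frob_norm M"
proof -
  have "vec_norm2 (col (Q * M) j) = vec_norm2 (col M j)" if "j < dim_col M" for j
  proof -
    have "col (Q * M) j = Q *\<^sub>v col M j"
      using assms that by (intro col_mult2[of _ "dim_row Q" "dim_col Q" _ "dim_col M"]) auto
    then show ?thesis using assms by (simp add: vec_norm2_orthonormal_mult)
  qed
  then have "(frob_norm (Q * M))\<^sup>2 = (frob_norm M)\<^sup>2" unfolding frob_norm_square_cols by simp
  then show ?thesis by (simp add: power2_eq_iff_nonneg)
qed

lemma spectral_norm_orthonormal_mult_le:
  assumes "orthonormal_cols Q" "dim_col Q = dim_row M"
  shows "spectral_norm (Q * M) \<le> spectral_norm M"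
proof (rule spectral_norm_leI)
  fix v assume v: "v \<in> carrier_vec (dim_col (Q * M))" "vec_norm2 v \<le> 1"
  have "(Q * M) *\<^sub>v v = Q *\<^sub>v (M *\<^sub>v v)"
    using assms v by (intro assoc_mult_mat_vec[of _ "dim_row Q" "dim_col Q" _ "dim_col M"]) auto
  then have "vec_norm2 ((Q * M) *\<^sub>v v) = vec_norm2 (M *\<^sub>v v)"
    using assms by (simp add: vec_norm2_orthonormal_mult carrier_vecI)
  then show "vec_norm2 ((Q * M) *\<^sub>v v) \<le> spectral_norm M"
    using vec_norm2_mult_le_spectral_norm[of v M] v by simp
qed

subsection \<open>Pseudoinverses and orthogonal complements\<close>

lemma real_mat_injective_imp_inverse:
  fixes R :: "real mat"
  assumes R: "R \<in> carrier_mat n n"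
    and inj: "\<And>v. v \<in> carrier_vec n \<Longrightarrow> R *\<^sub>v v = 0\<^sub>v n \<Longrightarrow> v = 0\<^sub>v n"
  obtains S where "S \<in> carrier_mat n n" "S * R = 1\<^sub>m n" "R * S = 1\<^sub>m n"
proof -
  have "det R \<noteq> 0" using det_0_iff_vec_prod_zero_field[OF R] inj by auto
  \<comment> \<open>The value \<open>()\<close> fills a dummy parameter of the matrix ring;
    unfolding what a unit of that ring is yields the two-sided inverse.\<close>
  from det_non_zero_imp_unit[OF R this, of "()"] show ?thesis
    by (auto simp: Units_def ring_mat_simps intro: that)
qed

text \<open>Linear independence speaks of the set of columns, so repeated columns have to be
  excluded first. A maximal independent subset of the columns has \<open>n\<close> elements, hence
  the \<open>n\<close> columns are distinct, and a nonzero kernel vector would make them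
  dependent.\<close>

lemma full_col_rank_imp_injective:
  assumes M: "M \<in> carrier_mat m n" and rk: "full_col_rank M"
    and v: "v \<in> carrier_vec n" and Mv: "M *\<^sub>v v = 0\<^sub>v m"
  shows "v = 0\<^sub>v n"
proof (rule ccontr)
  assume v0: "v \<noteq> 0\<^sub>v n"
  interpret vec_space "TYPE(real)" m .
  have rank: "rank M = n" using M rk by (simp add: full_col_rank_def)
  obtain S where S: "maximal S (\<lambda>T. T \<subseteq> set (cols M) \<and> lin_indpt T)"
    using maximal_exists[of "\<lambda>T. T \<subseteq> set (cols M) \<and> lin_indpt T" "card (set (cols M))" "{}"]
    by (meson List.finite_set card_mono empty_iff empty_subsetI finite_lin_indpt2 rev_finite_subset)
  have "card S \<le> card (set (cols M))" using S by (simp add: card_mono maximal_def)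
  then have "n \<le> card (set (cols M))" using rank_card_indpt[OF M S] rank by simp
  then have "distinct (cols M)"
    using M card_length[of "cols M"] by (intro card_distinct) auto
  then show False
    using full_rank_lin_indpt[OF M rank] lin_depI[OF M v v0 Mv] by blast
qed

text \<open>The pseudoinverse is \<open>S * M\<^sup>T\<close> with \<open>S\<close> the inverse of
  the Gram matrix \<open>M\<^sup>T * M\<close>. That inverse exists because a kernel vector
  \<open>v\<close> of the Gram matrix satisfies
  \<open>(M *\<^sub>v v) \<bullet> (M *\<^sub>v v) = 0\<close>.\<close>

lemma pseudo_inverse_of_injective:
  assumes M: "M \<in> carrier_mat m n"
    and inj: "\<And>v. v \<in> carrier_vec n \<Longrightarrow> M *\<^sub>v v = 0\<^sub>v m \<Longrightarrow> v = 0\<^sub>v n"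
  shows "is_pseudo_inverse M (pseudo_inverse M)" "pseudo_inverse M * M = 1\<^sub>m n"
proof -
  have inj': "v = 0\<^sub>v n" if v: "v \<in> carrier_vec n" and 0: "(M\<^sup>T * M) *\<^sub>v v = 0\<^sub>v n" for v
  proof (rule inj[OF v])
    have "(M *\<^sub>v v) \<bullet> (M *\<^sub>v v) = 0"
      using scalar_prod_mult_mat_vec_self[OF M v] 0 v by simp
    then have "vec_norm2 (M *\<^sub>v v) = 0" by (simp add: vec_norm2_def)
    then show "M *\<^sub>v v = 0\<^sub>v m" using M v by (subst (asm) vec_norm2_eq_0_iff[of _ m]) auto
  qed
  have MTM: "M\<^sup>T * M \<in> carrier_mat n n" and MT: "M\<^sup>T \<in> carrier_mat n m" using M by auto
  obtain S where S: "S \<in> carrier_mat n n" "S * (M\<^sup>T * M) = 1\<^sub>m n" "(M\<^sup>T * M) * S = 1\<^sub>m n"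
    using real_mat_injective_imp_inverse[OF MTM inj'] by blast
  \<comment> \<open>The transpose of \<open>S\<close> inverts the symmetric Gram matrix as well, so
    \<open>S\<close> is symmetric; this makes \<open>M * X\<close> symmetric below.\<close>
  have ST: "S\<^sup>T \<in> carrier_mat n n" using S(1) by simp
  have "S\<^sup>T * (M\<^sup>T * M) = ((M\<^sup>T * M) * S)\<^sup>T"
    unfolding transpose_mult[OF MTM S(1)] transpose_mult[OF MT M] by simp
  then have 1: "S\<^sup>T * (M\<^sup>T * M) = 1\<^sub>m n" using S(3) by simp
  have "S\<^sup>T = S\<^sup>T * ((M\<^sup>T * M) * S)" using S ST by simp
  also have "\<dots> = S" using assoc_mult_mat[OF ST MTM S(1)] 1 S(1) by simp
  finally have Ssym: "S\<^sup>T = S" .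
  define X where "X = S * M\<^sup>T"
  have X: "X \<in> carrier_mat n m" using S(1) MT by (simp add: X_def)
  have XM: "X * M = 1\<^sub>m n" using assoc_mult_mat[OF S(1) MT M] S(2) by (simp add: X_def)
  have "(M * X)\<^sup>T = X\<^sup>T * M\<^sup>T" by (rule transpose_mult[OF M X])
  also have "X\<^sup>T = M * S" unfolding X_def transpose_mult[OF S(1) MT] Ssym by simp
  also have "M * S * M\<^sup>T = M * X" unfolding X_def by (rule assoc_mult_mat[OF M S(1) MT])
  finally have "is_pseudo_inverse M X"
    unfolding is_pseudo_inverse_def using X M XM by (simp add: assoc_mult_mat[OF M X M])
  moreover from this have "pseudo_inverse M = X" by (rule pseudo_inverse_eqI)
  ultimately show "is_pseudo_inverse M (pseudo_inverse M)" "pseudo_inverse M * M = 1\<^sub>m n"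
    using XM by auto
qed

text \<open>Such a reverse order law fails for general \<open>M\<close>. Here
  \<open>pseudo_inverse M\<close> is a left inverse, so one of the two products in the Penrose
  conditions is the identity and the other is \<open>M * pseudo_inverse M\<close>, both
  symmetric.\<close>

lemma pseudo_inverse_mult_invertible:
  assumes M: "M \<in> carrier_mat m n"
    and inj: "\<And>v. v \<in> carrier_vec n \<Longrightarrow> M *\<^sub>v v = 0\<^sub>v m \<Longrightarrow> v = 0\<^sub>v n"
    and R: "R \<in> carrier_mat n n" and S: "S \<in> carrier_mat n n" and SR: "S * R = 1\<^sub>m n" and RS: "R * S = 1\<^sub>m n"
  shows "pseudo_inverse (M * R) = S * pseudo_inverse M"
proof (rule pseudo_inverse_eqI)
  define X where "X = pseudo_inverse M"
  have X: "X \<in> carrier_mat n m" and sym: "(M * X)\<^sup>T = M * X" and XM: "X * M = 1\<^sub>m n"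
    using pseudo_inverse_of_injective[OF M inj] M by (simp_all add: is_pseudo_inverse_def X_def)
  have SX: "S * X \<in> carrier_mat n m" and MR: "M * R \<in> carrier_mat m n" using S X M R by simp_all
  have "M * R * (S * X) = M * (R * (S * X))" by (rule assoc_mult_mat[OF M R SX])
  also have "R * (S * X) = X" using assoc_mult_mat[OF R S X] RS X by simp
  finally have 1: "M * R * (S * X) = M * X" .
  have "S * X * (M * R) = S * (X * (M * R))" by (rule assoc_mult_mat[OF S X MR])
  also have "X * (M * R) = R" using assoc_mult_mat[OF X M R] XM R by simp
  finally have 2: "S * X * (M * R) = 1\<^sub>m n" using SR by simp
  have "M * R * (S * X) * (M * R) = M * R * (S * X * (M * R))"
    by (rule assoc_mult_mat[OF MR SX MR])
  then have "M * R * (S * X) * (M * R) = M * R" unfolding 2 right_mult_one_mat[OF MR] .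
  moreover have "S * X * (M * R) * (S * X) = S * X" unfolding 2 left_mult_one_mat[OF SX] ..
  moreover have "(M * R * (S * X))\<^sup>T = M * R * (S * X)" unfolding 1 by (rule sym)
  moreover have "(S * X * (M * R))\<^sup>T = S * X * (M * R)" unfolding 2 by simp
  moreover have "S * X \<in> carrier_mat (dim_col (M * R)) (dim_row (M * R))" using SX M R by simp
  ultimately show "is_pseudo_inverse (M * R) (S * pseudo_inverse M)"
    unfolding is_pseudo_inverse_def X_def[symmetric] by blast
qed

text \<open>Both sides are the orthogonal projection onto the complement of the range of
  \<open>Q\<close>; they are compared column by column.\<close>

lemma orthonormal_complement_projections:
  assumes Q: "Q \<in> carrier_mat n r" and oQ: "orthonormal_cols Q"
    and B: "B \<in> carrier_mat n s" and compl: "orthonormal_basis_of_complement B Q"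
  shows "B * B\<^sup>T = 1\<^sub>m n - Q * Q\<^sup>T"
proof -
  interpret vec_space "TYPE(real)" n .
  have oB: "B\<^sup>T * B = 1\<^sub>m s" and QQ: "Q\<^sup>T * Q = 1\<^sub>m r" using assms
    by (auto simp: orthonormal_basis_of_complement_def orthonormal_cols_def)
  have QT: "Q\<^sup>T \<in> carrier_mat r n" and BT: "B\<^sup>T \<in> carrier_mat s n" using Q B by auto
  \<comment> \<open>Orthogonality to the span of the columns reduces to orthogonality to each
    column, that is, to \<open>Q\<^sup>T *\<^sub>v x = 0\<^sub>v r\<close>.\<close>
  have "col_space B = orthogonal_complement (col_space Q)"
    using compl Q B by (simp add: orthonormal_basis_of_complement_def)
  also have "col_space Q = span (set (cols Q))" by (simp add: col_space_def)
  also have "orthogonal_complement \<dots> = orthogonal_complement (set (cols Q))"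
    using Q cols_dim[of Q] by (intro in_orthogonal_complement_span) auto
  finally have cs: "{y\<in>carrier_vec n. \<exists>x\<in>carrier_vec s. B *\<^sub>v x = y} =
      {x \<in> carrier_vec n. \<forall>j<r. x \<bullet> col Q j = 0}"
    using Q B by (auto simp: col_space_eq[OF B] orthogonal_complement_def cols_def)
  have orth: "Q\<^sup>T *\<^sub>v x = 0\<^sub>v r \<longleftrightarrow> (\<forall>j<r. x \<bullet> col Q j = 0)" if x: "x \<in> carrier_vec n" for x
  proof -
    have "(Q\<^sup>T *\<^sub>v x) $ j = x \<bullet> col Q j" if "j < r" for j
      using that Q x by (simp add: comm_scalar_prod[of x n])
    then show ?thesis using Q by (auto simp: vec_eq_iff)
  qed
  have cs': "(\<exists>w\<in>carrier_vec s. B *\<^sub>v w = x) \<longleftrightarrow> Q\<^sup>T *\<^sub>v x = 0\<^sub>v r"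
    if "x \<in> carrier_vec n" for x
    using cs orth[OF that] that by blast
  have QB: "Q\<^sup>T * B = 0\<^sub>m r s"
  proof (rule mat_col_eqI)
    fix j assume j: "j < dim_col (0\<^sub>m r s :: real mat)"
    then have "col B j = B *\<^sub>v col (1\<^sub>m s) j"
      using col_mult2[OF B one_carrier_mat, of j] B by simp
    then have "Q\<^sup>T *\<^sub>v col B j = 0\<^sub>v r" using cs'[of "col B j"] B j
      by (metis carrier_matD(1) col_carrier_vec col_dim index_zero_mat(3) one_carrier_mat)
    then show "col (Q\<^sup>T * B) j = col (0\<^sub>m r s) j" using j col_mult2[OF QT B] by simp
  qed (use Q B in auto)
  have BQ: "B\<^sup>T * Q = 0\<^sub>m s r"
  proof -
    have "B\<^sup>T * Q = (Q\<^sup>T * B)\<^sup>T" unfolding transpose_mult[OF QT B] by simp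
    then show ?thesis using QB by simp
  qed
  show ?thesis
  proof (rule mat_col_eqI)
    show "dim_row (B * B\<^sup>T) = dim_row (1\<^sub>m n - Q * Q\<^sup>T)" "dim_col (B * B\<^sup>T) = dim_col (1\<^sub>m n - Q * Q\<^sup>T)"
      using B Q by auto
    fix j assume "j < dim_col (1\<^sub>m n - Q * Q\<^sup>T)"
    then have j: "j < n" using Q by simp
    \<comment> \<open>This column is orthogonal to the range of \<open>Q\<close>, hence of the form
      \<open>B *\<^sub>v w\<close>; applying \<open>B\<^sup>T\<close> identifies \<open>w\<close> as
      column \<open>j\<close> of \<open>B\<^sup>T\<close>.\<close>
    define x where "x = col (1\<^sub>m n - Q * Q\<^sup>T) j"
    have x: "x \<in> carrier_vec n" using Q by (auto simp: x_def intro: carrier_vecI)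
    have D: "1\<^sub>m n - Q * Q\<^sup>T \<in> carrier_mat n n" using Q by auto
    have "Q\<^sup>T * (1\<^sub>m n - Q * Q\<^sup>T) = Q\<^sup>T * 1\<^sub>m n - Q\<^sup>T * (Q * Q\<^sup>T)"
      using Q by (intro mult_minus_distrib_mat[OF QT]) auto
    also have "Q\<^sup>T * (Q * Q\<^sup>T) = Q\<^sup>T" using assoc_mult_mat[OF QT Q QT] QQ QT by simp
    finally have QD: "Q\<^sup>T * (1\<^sub>m n - Q * Q\<^sup>T) = 0\<^sub>m r n" using QT by simp
    have "Q\<^sup>T *\<^sub>v x = col (0\<^sub>m r n) j"
      unfolding x_def QD[symmetric] using j by (intro col_mult2[symmetric, OF QT D]) 
    then obtain w where w: "w \<in> carrier_vec s" "B *\<^sub>v w = x" using cs'[OF x] j by auto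
    have "B\<^sup>T * (1\<^sub>m n - Q * Q\<^sup>T) = B\<^sup>T * 1\<^sub>m n - B\<^sup>T * (Q * Q\<^sup>T)"
      using Q by (intro mult_minus_distrib_mat[OF BT]) auto
    also have "B\<^sup>T * (Q * Q\<^sup>T) = 0\<^sub>m s n" using assoc_mult_mat[OF BT Q QT] BQ QT by simp
    finally have BD: "B\<^sup>T * (1\<^sub>m n - Q * Q\<^sup>T) = B\<^sup>T" using B by (auto intro!: eq_matI)
    have "B\<^sup>T *\<^sub>v x = w"
      using assoc_mult_mat_vec[OF BT B w(1)] w oB by simp
    moreover have "B\<^sup>T *\<^sub>v x = col B\<^sup>T j"
      using col_mult2[OF BT D j] BD by (simp add: x_def)
    ultimately show "col (B * B\<^sup>T) j = col (1\<^sub>m n - Q * Q\<^sup>T) j"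
      using col_mult2[OF B BT j] w by (simp add: x_def)
  qed
qed

subsection \<open>Mixed radix expansions\<close>

text \<open>The digit of weight \<open>a\<close> and radix \<open>b\<close> depends only on the
  residue modulo \<open>a * b\<close>. This serves to cut off more significant digits.\<close>

lemma digit_mod:
  fixes c :: nat
  assumes "a * b dvd m"
  shows "(c mod m) div a mod b = c div a mod b"
proof (cases "a = 0")
  case False
  have *: "x mod (a * b) div a = x div a mod b" for x
    using False by (simp add: mod_mult2_eq)
  have "(c mod m) div a mod b = (c mod m) mod (a * b) div a" by (simp only: *)
  also have "(c mod m) mod (a * b) = c mod (a * b)" using assms by (rule mod_mod_cancel)
  finally show ?thesis by (simp only: *)
qed simp

lemma prod_lessThan_Suc_dvd:
  fixes w :: "nat \<Rightarrow> nat"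
  assumes "i < d"
  shows "(\<Prod>m<i. w m) * w i dvd (\<Prod>m<d. w m)"
proof -
  have "(\<Prod>m<i. w m) * w i = (\<Prod>m<Suc i. w m)" by simp
  also have "\<dots> dvd (\<Prod>m<d. w m)" using assms by (intro prod_dvd_prod_subset) auto
  finally show ?thesis .
qed

text \<open>Induction on the number of digits. With \<open>p\<close> the weight of the leading
  digit, \<open>c mod p\<close> keeps the lower digits, and \<open>c div p\<close> is the leading
  digit itself because the bound on \<open>c\<close> keeps it below its radix.\<close>

lemma mixed_radix_digits_inj:
  fixes w :: "nat \<Rightarrow> nat"
  assumes "\<And>i. i < d \<Longrightarrow> c div (\<Prod>m<i. w m) mod w i = c' div (\<Prod>m<i. w m) mod w i"
    and "c < (\<Prod>m<d. w m)" "c' < (\<Prod>m<d. w m)"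
  shows "c = c'"
  using assms
proof (induction d arbitrary: c c')
  case (Suc d)
  define p where "p = (\<Prod>m<d. w m)"
  have bounds: "c < w d * p" "c' < w d * p"
    using Suc.prems(2,3) by (simp_all add: p_def mult.commute)
  \<comment> \<open>Radices may be zero in general; the strict bound on \<open>c\<close> rules this
    out.\<close>
  then have p: "p > 0" using gr0I by fastforce
  have "c mod p = c' mod p"
  proof (rule Suc.IH)
    fix i assume i: "i < d"
    then have "(\<Prod>m<i. w m) * w i dvd p" unfolding p_def by (rule prod_lessThan_Suc_dvd)
    then show "c mod p div (\<Prod>m<i. w m) mod w i = c' mod p div (\<Prod>m<i. w m) mod w i"
      using Suc.prems(1)[of i] i by (simp add: digit_mod)
  qed (use p in \<open>simp_all add: p_def[symmetric]\<close>)
  moreover have "c div p = c' div p"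
    using Suc.prems(1)[of d] bounds by (simp add: p_def[symmetric] less_mult_imp_div_less)
  ultimately show ?case by (metis div_mult_mod_eq)
qed simp

lemma sum_lessThan_mult:
  fixes f :: "nat \<Rightarrow> 'a :: comm_monoid_add"
  shows "(\<Sum>p<b * a. f p) = (\<Sum>j<b. \<Sum>p<a. f (j * a + p))"
proof -
  have "sum f {j * a..<j * a + a} = (\<Sum>p<a. f (j * a + p))" for j
    using sum.shift_bounds_nat_ivl[of f 0 "j * a" a] by (simp add: atLeast0LessThan add.commute)
  then show ?thesis using sum.nat_group[of f a b] by simp
qed

lemma prod_diff_singleton_split:
  fixes f :: "nat \<Rightarrow> 'a :: comm_monoid_mult"
  assumes "k < i"
  shows "(\<Prod>m\<in>{..<i} - {k}. f m) = (\<Prod>m<k. f m) * (\<Prod>m\<in>{k<..<i}. f m)"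
proof -
  have "{..<i} - {k} = {..<k} \<union> {k<..<i}" using assms by auto
  then show ?thesis by (simp add: prod.union_disjoint disjoint_iff)
qed

subsection \<open>Mode products\<close>

text \<open>Injectivity is the uniqueness of mixed radix expansions. Surjectivity follows by
  counting, so that no inverse has to be written down.\<close>

lemma matricize_index_bij:
  assumes k: "k < tensor_order T"
  shows "bij_betw (\<lambda>(a, c). matricize_index T k a c)
    ({..<tensor_dim T k} \<times> {..<(\<Prod>i\<in>{..<tensor_order T} - {k}. tensor_dim T i)}) (tensor_indices T)"
    (is "bij_betw ?f ?D _")
proof -
  let ?d = "tensor_order T" and ?n = "tensor_dim T"
  \<comment> \<open>Radix \<open>1\<close> at position \<open>k\<close> makes the digit there trivial, so that no position is skipped.\<close>
  define w where "w m = (if m = k then 1 else ?n m)" for m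
  have w: "(\<Prod>m\<in>{..<i} - {k}. ?n m) = (\<Prod>m<i. w m)" for i
  proof -
    have "(\<Prod>m\<in>{..<i} - {k}. ?n m) = (\<Prod>m\<in>{..<i} - {k}. w m)"
      by (rule prod.cong) (auto simp: w_def)
    also have "\<dots> = (\<Prod>m<i. w m)"
      by (rule prod.mono_neutral_left) (auto simp: w_def)
    finally show ?thesis .
  qed
  have inj: "inj_on ?f ?D"
  proof (rule inj_onI, clarsimp)
    fix a c a' c'
    assume c: "c < (\<Prod>i\<in>{..<?d} - {k}. ?n i)" "c' < (\<Prod>i\<in>{..<?d} - {k}. ?n i)"
      and eq: "matricize_index T k a c = matricize_index T k a' c'"
    have "a = a'" using fun_cong[OF eq, of k] k by (simp add: matricize_index_def)
    moreover have "c = c'"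
    proof (rule mixed_radix_digits_inj)
      fix i assume i: "i < ?d"
      show "c div (\<Prod>m<i. w m) mod w i = c' div (\<Prod>m<i. w m) mod w i"
      proof (cases "i = k")
        case True
        then show ?thesis by (simp add: w_def)
      next
        case False
        then show ?thesis using fun_cong[OF eq, of i] i
          by (simp add: matricize_index_def w) (simp add: w_def)
      qed
    qed (use c w in simp_all)
    ultimately show "a = a' \<and> c = c'" by simp
  qed
  have sub: "?f ` ?D \<subseteq> tensor_indices T"
  proof clarsimp
    fix a c
    assume a: "a < ?n k" and c: "c < (\<Prod>i\<in>{..<?d} - {k}. ?n i)"
    \<comment> \<open>A column exists only if no other dimension is zero; then each digit, a
      remainder modulo its dimension, is in range.\<close>
    then have "(\<Prod>i\<in>{..<?d} - {k}. ?n i) \<noteq> 0" by linarith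
    then have "?n i > 0" if "i < ?d" "i \<noteq> k" for i
      using that by (auto simp: prod_zero_iff)
    then show "matricize_index T k a c \<in> tensor_indices T"
      using a by (auto simp: matricize_index_def tensor_indices_def)
  qed
  have "card (?f ` ?D) = card (tensor_indices T)"
    using k prod.remove[of "{..<?d}" k ?n]
    by (simp add: card_image[OF inj] card_cartesian_product tensor_indices_def card_PiE)
  moreover have "finite (tensor_indices T)" by (auto simp: tensor_indices_def intro: finite_PiE)
  ultimately have "?f ` ?D = tensor_indices T" using sub card_subset_eq by blast
  with inj show ?thesis by (simp add: bij_betw_def)
qed

lemma tensor_norm_eq_frob_norm_matricize:
  assumes "k < tensor_order T"
  shows "tensor_norm T = frob_norm (matricize T k)"
proof -
  have "(\<Sum>I\<in>tensor_indices T. (tensor_entry T I)\<^sup>2) =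
      (\<Sum>(a, c)\<in>{..<tensor_dim T k} \<times> {..<(\<Prod>i\<in>{..<tensor_order T} - {k}. tensor_dim T i)}.
        (tensor_entry T (matricize_index T k a c))\<^sup>2)"
    by (subst sum.reindex_bij_betw[OF matricize_index_bij[OF assms], symmetric])
      (simp add: case_prod_unfold)
  then show ?thesis
    by (simp add: tensor_norm_def frob_norm_def matricize_def sum.cartesian_product)
qed

section \<open>Commutation and norm bounds for mode products\<close>

lemma tensor_order_mode_product [simp]: "tensor_order (mode_product T k X) = tensor_order T"
  by (simp add: mode_product_def)

lemma tensor_dim_mode_product [simp]:
  "tensor_dim (mode_product T k X) = (tensor_dim T)(k := dim_row X)"
  by (simp add: mode_product_def)

lemma tensor_entry_mode_product:
  "tensor_entry (mode_product T k X) I =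
     (\<Sum>j<tensor_dim T k. X $$ (I k, j) * tensor_entry T (I(k := j)))"
  by (simp add: mode_product_def)

text \<open>The two finite sums are interchanged. Equality holds at every index, not only at those
  in \<open>tensor_indices\<close>, so it can be used inside further products.\<close>

lemma mode_product_commute:
  assumes "i \<noteq> j"
  shows "mode_product (mode_product T i X) j Z = mode_product (mode_product T j Z) i X"
proof (rule tensor.expand, intro conjI)
  show "tensor_entry (mode_product (mode_product T i X) j Z) =
      tensor_entry (mode_product (mode_product T j Z) i X)"
  proof
    fix I
    have "tensor_entry (mode_product (mode_product T i X) j Z) I =
        (\<Sum>b<tensor_dim T j. \<Sum>a<tensor_dim T i.
          Z $$ (I j, b) * X $$ (I i, a) * tensor_entry T (I(j := b, i := a)))"
      using assms by (simp add: tensor_entry_mode_product sum_distrib_left mult.assoc)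
    also have "\<dots> = (\<Sum>a<tensor_dim T i. \<Sum>b<tensor_dim T j.
          Z $$ (I j, b) * X $$ (I i, a) * tensor_entry T (I(j := b, i := a)))"
      by (rule sum.swap)
    also have "\<dots> = tensor_entry (mode_product (mode_product T j Z) i X) I"
      using assms
      by (simp add: tensor_entry_mode_product sum_distrib_left fun_upd_twist[of j i] mult.left_commute mult.assoc)
    finally show "tensor_entry (mode_product (mode_product T i X) j Z) I =
        tensor_entry (mode_product (mode_product T j Z) i X) I" .
  qed
qed (use assms in \<open>simp_all add: fun_upd_twist[of j i]\<close>)

text \<open>In the mode-\<open>k\<close> matricization both factors act from the left, so
  \<open>W\<close> can be split off by the matrix inequality.\<close>

lemma tensor_norm_mode_product_mult_le:
  assumes "k < tensor_order T" "dim_col Z = tensor_dim T k" "dim_col W = dim_row Z"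
  shows "tensor_norm (mode_product T k (W * Z)) \<le> spectral_norm W * tensor_norm (mode_product T k Z)"
proof -
  have dim: "dim_row (matricize T k) = dim_col Z" using assms by (simp add: matricize_def)
  have "tensor_norm (mode_product T k (W * Z)) = frob_norm (W * Z * matricize T k)"
    using assms by (simp add: tensor_norm_eq_frob_norm_matricize[of k] matricize_mode_product)
  also have "W * Z * matricize T k = W * (Z * matricize T k)"
    using assms dim by (intro assoc_mult_mat[of _ "dim_row W" "dim_row Z" _ "dim_col Z"])
      (auto intro: carrier_matI)
  also have "frob_norm \<dots> \<le> spectral_norm W * frob_norm (Z * matricize T k)"
    using assms by (intro frob_norm_mult_le) simp
  also have "frob_norm (Z * matricize T k) = tensor_norm (mode_product T k Z)"
    using assms by (simp add: tensor_norm_eq_frob_norm_matricize[of k] matricize_mode_product)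
  finally show ?thesis .
qed

text \<open>This is \<open>multi_mode_product\<close> stopped before mode \<open>k\<close>. It
  supplies the partial approximants of the telescoping sum and, with transposed sketches, the
  tensors behind \<open>smln_unfolding\<close>.\<close>

definition initial_mode_product :: "tensor \<Rightarrow> (nat \<Rightarrow> real mat) \<Rightarrow> nat \<Rightarrow> tensor" where
  "initial_mode_product T P k = fold (\<lambda>i S. mode_product S i (P i)) [0..<k] T"

lemma initial_mode_product_0 [simp]: "initial_mode_product T P 0 = T"
  by (simp add: initial_mode_product_def)

lemma initial_mode_product_Suc [simp]:
  "initial_mode_product T P (Suc k) = mode_product (initial_mode_product T P k) k (P k)"
  by (simp add: initial_mode_product_def)

lemma tensor_order_initial_mode_product [simp]:
  "tensor_order (initial_mode_product T P k) = tensor_order T"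
  by (induction k) auto

lemma tensor_dim_initial_mode_product [simp]:
  "tensor_dim (initial_mode_product T P k) i = (if i < k then dim_row (P i) else tensor_dim T i)"
  by (induction k) auto

text \<open>All modes below \<open>k\<close> differ from \<open>j\<close>. Hence the factor in mode
  \<open>j\<close> may be applied first or last, as convenient.\<close>

lemma initial_mode_product_commute:
  "k \<le> j \<Longrightarrow> initial_mode_product (mode_product T j X) P k = mode_product (initial_mode_product T P k) j X"
  by (induction k) (auto simp: mode_product_commute)

lemma initial_mode_product_cong:
  "(\<And>i. i < k \<Longrightarrow> P i = P' i) \<Longrightarrow> initial_mode_product T P k = initial_mode_product T P' k"
  by (induction k) auto

text \<open>Induction for all \<open>T\<close> at once: \<open>W k\<close> comes off the outermost
  mode, then \<open>Z k\<close> is carried into the tensor, and the induction hypothesis for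
  \<open>mode_product T k (Z k)\<close> removes the remaining \<open>W i\<close>.\<close>

lemma tensor_norm_initial_mode_product_mult_le:
  assumes "k \<le> tensor_order T"
    and "\<And>i. i < k \<Longrightarrow> dim_col (Z i) = tensor_dim T i \<and> dim_col (W i) = dim_row (Z i)"
  shows "tensor_norm (initial_mode_product T (\<lambda>i. W i * Z i) k)
    \<le> (\<Prod>i<k. spectral_norm (W i)) * tensor_norm (initial_mode_product T Z k)"
  using assms
proof (induction k arbitrary: T)
  case (Suc k)
  let ?WZ = "\<lambda>i. W i * Z i"
  have "tensor_norm (initial_mode_product T ?WZ (Suc k))
      \<le> spectral_norm (W k) * tensor_norm (mode_product (initial_mode_product T ?WZ k) k (Z k))"
    using Suc.prems unfolding initial_mode_product_Suc
    by (intro tensor_norm_mode_product_mult_le) auto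
  also have "mode_product (initial_mode_product T ?WZ k) k (Z k)
      = initial_mode_product (mode_product T k (Z k)) ?WZ k"
    by (simp add: initial_mode_product_commute)
  also have "spectral_norm (W k) * tensor_norm \<dots> \<le> spectral_norm (W k) *
      ((\<Prod>i<k. spectral_norm (W i)) * tensor_norm (initial_mode_product (mode_product T k (Z k)) Z k))"
    using Suc.prems by (intro mult_left_mono Suc.IH) auto
  finally show ?case
    by (simp add: initial_mode_product_commute mult.assoc mult.commute mult.left_commute)
qed simp

section \<open>Kronecker products as products along the lower modes\<close>

lemma dim_kron_below [simp]:
  "dim_row (kron_below Y k) = (\<Prod>i<k. dim_row (Y i))"
  "dim_col (kron_below Y k) = (\<Prod>i<k. dim_col (Y i))"
  by (induction k) (simp_all add: kronecker_def mult.commute)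

text \<open>Column \<open>c\<close> encodes the target indices and row \<open>p\<close> the source
  indices, the lowest mode being least significant. Each induction step peels off the leading digit,
  which belongs to the left Kronecker factor.\<close>

lemma initial_mode_product_transpose_entry:
  assumes "\<And>i. i < k \<Longrightarrow> dim_row (Y i) = tensor_dim A i"
    and "c < (\<Prod>i<k. dim_col (Y i))"
    and "\<And>i. i < k \<Longrightarrow> I i = c div (\<Prod>m<i. dim_col (Y m)) mod dim_col (Y i)"
  shows "tensor_entry (initial_mode_product A (\<lambda>i. (Y i)\<^sup>T) k) I =
    (\<Sum>p<(\<Prod>i<k. dim_row (Y i)). kron_below Y k $$ (p, c) * tensor_entry A
      (\<lambda>i. if i < k then p div (\<Prod>m<i. dim_row (Y m)) mod dim_row (Y i) else I i))"
  using assms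
proof (induction k arbitrary: c I)
  case (Suc k)
  define P S where "P = (\<Prod>i<k. dim_row (Y i))" and "S = (\<Prod>i<k. dim_col (Y i))"
  let ?a = "\<lambda>p i. p div (\<Prod>m<i. dim_row (Y m)) mod dim_row (Y i)"
  have c: "c < dim_col (Y k) * S" using Suc.prems(2) by (simp add: S_def mult.commute)
  then have S: "S > 0" using gr0I by fastforce
  have cS: "c div S < dim_col (Y k)" using c by (rule less_mult_imp_div_less)
  have Ik: "I k = c div S" using Suc.prems(3)[of k] cS by (simp add: S_def)
  \<comment> \<open>Dropping the leading digit replaces \<open>c\<close> by \<open>c mod S\<close>;
    the induction hypothesis is used at an index whose entry at \<open>k\<close> is the summation
    variable.\<close>
  have entry: "tensor_entry (initial_mode_product A (\<lambda>i. (Y i)\<^sup>T) k) (I(k := j)) =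
      (\<Sum>p<P. kron_below Y k $$ (p, c mod S) * tensor_entry A (\<lambda>i. if i < k then ?a p i else (I(k := j)) i))"
    for j unfolding P_def
  proof (rule Suc.IH)
    fix i assume i: "i < k"
    then have "(\<Prod>m<i. dim_col (Y m)) * dim_col (Y i) dvd S"
      unfolding S_def by (rule prod_lessThan_Suc_dvd)
    then show "(I(k := j)) i = c mod S div (\<Prod>m<i. dim_col (Y m)) mod dim_col (Y i)"
      using Suc.prems(3)[of i] i by (simp add: digit_mod)
  qed (use Suc.prems(1) S in \<open>simp_all add: S_def[symmetric]\<close>)
  \<comment> \<open>Row \<open>j * P + p\<close> has leading digit \<open>j\<close> and remainder
    \<open>p\<close>, so the Kronecker entry factors and the source index is that of
    \<open>p\<close> with \<open>j\<close> at position \<open>k\<close>.\<close>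
  have term_eq: "kron_below Y (Suc k) $$ (j * P + p, c) *
        tensor_entry A (\<lambda>i. if i < Suc k then ?a (j * P + p) i else I i) =
      Y k $$ (j, I k) * (kron_below Y k $$ (p, c mod S) *
        tensor_entry A (\<lambda>i. if i < k then ?a p i else (I(k := j)) i))"
    if j: "j < dim_row (Y k)" and p: "p < P" for j p
  proof -
    have "?a (j * P + p) i = ?a p i" if i: "i < k" for i
    proof -
      have "(\<Prod>m<i. dim_row (Y m)) * dim_row (Y i) dvd P"
        unfolding P_def using i by (rule prod_lessThan_Suc_dvd)
      from digit_mod[OF this, of "j * P + p"] show ?thesis using p by simp
    qed
    moreover have "?a (j * P + p) k = j" using j p by (simp add: P_def[symmetric])
    ultimately have idx: "(\<lambda>i. if i < Suc k then ?a (j * P + p) i else I i) =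
        (\<lambda>i. if i < k then ?a p i else (I(k := j)) i)"
      by (auto simp: fun_eq_iff less_Suc_eq)
    have "j * P + p < dim_row (Y k) * P"
    proof -
      have "j * P + p < Suc j * P" using p by simp
      also have "\<dots> \<le> dim_row (Y k) * P" using j by (intro mult_le_mono1) simp
      finally show ?thesis .
    qed
    then have "kron_below Y (Suc k) $$ (j * P + p, c) = Y k $$ (j, I k) * kron_below Y k $$ (p, c mod S)"
      using p c by (simp add: kronecker_def P_def[symmetric] S_def[symmetric] Ik)
    then show ?thesis unfolding idx by simp
  qed
  have "tensor_entry (initial_mode_product A (\<lambda>i. (Y i)\<^sup>T) (Suc k)) I =
      (\<Sum>j<dim_row (Y k). Y k $$ (j, I k) * tensor_entry (initial_mode_product A (\<lambda>i. (Y i)\<^sup>T) k) (I(k := j)))"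
    using Suc.prems(1)[of k] cS by (simp add: tensor_entry_mode_product Ik)
  also have "\<dots> = (\<Sum>j<dim_row (Y k). \<Sum>p<P. kron_below Y (Suc k) $$ (j * P + p, c) *
        tensor_entry A (\<lambda>i. if i < Suc k then ?a (j * P + p) i else I i))"
    unfolding entry sum_distrib_left using term_eq by (intro sum.cong) auto
  also have "\<dots> = (\<Sum>p<dim_row (Y k) * P. kron_below Y (Suc k) $$ (p, c) *
        tensor_entry A (\<lambda>i. if i < Suc k then ?a p i else I i))"
    by (rule sum_lessThan_mult[symmetric])
  also have "dim_row (Y k) * P = (\<Prod>i<Suc k. dim_row (Y i))" by (simp add: P_def mult.commute)
  finally show ?case .
qed simp

text \<open>A column \<open>c\<close> splits into \<open>c mod S\<close> for the modes below
  \<open>k\<close>, handled by the entry formula, and \<open>c div S\<close> for those above, which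
  the identity factor leaves alone.\<close>

lemma matricize_initial_mode_product_transpose:
  assumes k: "k < tensor_order A"
    and Y: "\<And>i. i < k \<Longrightarrow> dim_row (Y i) = tensor_dim A i"
  shows "matricize (initial_mode_product A (\<lambda>i. (Y i)\<^sup>T) k) k = smln_unfolding A Y k"
proof -
  let ?d = "tensor_order A" and ?n = "tensor_dim A"
  let ?T = "initial_mode_product A (\<lambda>i. (Y i)\<^sup>T) k"
  define P S N where "P = (\<Prod>i<k. dim_row (Y i))" and "S = (\<Prod>i<k. dim_col (Y i))"
    and "N = (\<Prod>i\<in>{k<..<?d}. ?n i)"
  let ?K = "kronecker (1\<^sub>m N) (kron_below Y k)"
  have Pn: "P = (\<Prod>i<k. ?n i)" unfolding P_def using Y by (intro prod.cong) auto
  have colA: "(\<Prod>i\<in>{..<?d} - {k}. ?n i) = N * P"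
    using k by (simp add: prod_diff_singleton_split Pn N_def mult.commute)
  have colT: "(\<Prod>i\<in>{..<?d} - {k}. tensor_dim ?T i) = N * S"
  proof -
    have "(\<Prod>i\<in>{k<..<?d}. tensor_dim ?T i) = N" unfolding N_def by (intro prod.cong) auto
    moreover have "(\<Prod>i<k. tensor_dim ?T i) = S" unfolding S_def by (intro prod.cong) auto
    ultimately show ?thesis using prod_diff_singleton_split[OF k, of "tensor_dim ?T"] by simp
  qed
  have dimK: "dim_row ?K = N * P" "dim_col ?K = N * S"
    by (simp_all add: kronecker_def P_def S_def)
  have unf: "smln_unfolding A Y k = matricize A k * ?K" by (simp add: smln_unfolding_def N_def)
  show ?thesis
  proof (rule eq_matI)
    fix a c assume "a < dim_row (smln_unfolding A Y k)" "c < dim_col (smln_unfolding A Y k)"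
    then have a: "a < ?n k" and c: "c < N * S"
      by (simp_all add: unf dimK matricize_def)
    then have S: "S > 0" using gr0I by fastforce
    have h: "c div S < N" using c by (rule less_mult_imp_div_less)
    define I where "I = matricize_index ?T k a c"
    have Ilow: "I i = c div (\<Prod>m<i. dim_col (Y m)) mod dim_col (Y i)" if i: "i < k" for i
    proof -
      have "(\<Prod>m\<in>{..<i} - {k}. tensor_dim ?T m) = (\<Prod>m<i. dim_col (Y m))"
        using i by (intro prod.cong) auto
      then show ?thesis using i k unfolding I_def matricize_index_def by simp
    qed
    have Ik: "I k = a" using k by (simp add: I_def matricize_index_def)
    \<comment> \<open>The weight of a mode above \<open>k\<close> contains the whole factor
      \<open>S\<close>, so its digit can be read off from \<open>c div S\<close>.\<close>
    have Ihigh: "I i = c div S div (\<Prod>m\<in>{k<..<i}. ?n m) mod ?n i" if i: "k < i" "i < ?d" for i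
    proof -
      have "(\<Prod>m\<in>{..<i} - {k}. tensor_dim ?T m) = S * (\<Prod>m\<in>{k<..<i}. ?n m)"
        unfolding prod_diff_singleton_split[OF i(1)] S_def
        by (intro arg_cong2[where f = "(*)"] prod.cong) auto
      then show ?thesis using i by (simp add: I_def matricize_index_def div_mult2_eq)
    qed
    \<comment> \<open>On the source side the lower block has size \<open>P\<close> instead of
      \<open>S\<close> and its digits come from \<open>p\<close>; the digits above \<open>k\<close>
      are unchanged.\<close>
    have idx: "matricize_index A k a (c div S * P + p) =
        (\<lambda>i. if i < k then p div (\<Prod>m<i. dim_row (Y m)) mod dim_row (Y i) else I i)"
      if p: "p < P" for p
    proof
      fix i
      show "matricize_index A k a (c div S * P + p) i =
          (if i < k then p div (\<Prod>m<i. dim_row (Y m)) mod dim_row (Y i) else I i)"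
      proof (cases i k rule: linorder_cases)
        case less
        have "(\<Prod>m<i. dim_row (Y m)) * dim_row (Y i) dvd P"
          unfolding P_def using less by (rule prod_lessThan_Suc_dvd)
        from digit_mod[OF this, of "c div S * P + p"]
        have "(c div S * P + p) div (\<Prod>m<i. dim_row (Y m)) mod dim_row (Y i) =
            p div (\<Prod>m<i. dim_row (Y m)) mod dim_row (Y i)" using p by simp
        moreover have "(\<Prod>m\<in>{..<i} - {k}. ?n m) = (\<Prod>m<i. dim_row (Y m))"
          using less Y by (intro prod.cong) auto
        ultimately show ?thesis using less k Y[OF less] by (simp add: matricize_index_def)
      next
        case equal
        then show ?thesis using k Ik by (simp add: matricize_index_def)
      next
        case greater
        show ?thesis
        proof (cases "i < ?d")
          case True
          have "(\<Prod>m\<in>{..<i} - {k}. ?n m) = P * (\<Prod>m\<in>{k<..<i}. ?n m)"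
            unfolding prod_diff_singleton_split[OF greater] Pn ..
          then show ?thesis using True greater p Ihigh[OF greater True]
            by (simp add: matricize_index_def div_mult2_eq)
        next
          case False
          then show ?thesis using greater by (simp add: I_def matricize_index_def)
        qed
      qed
    qed
    \<comment> \<open>The Kronecker product with an identity is block diagonal, so only the block
      \<open>j = c div S\<close> survives in the sum.\<close>
    have K: "?K $$ (j * P + p, c) = (if j = c div S then kron_below Y k $$ (p, c mod S) else 0)"
      if j: "j < N" and p: "p < P" for j p
    proof -
      have "j * P + p < Suc j * P" using p by simp
      also have "\<dots> \<le> N * P" using j by (intro mult_le_mono1) simp
      finally show ?thesis using j p c h
        by (simp add: kronecker_def P_def[symmetric] S_def[symmetric])
    qed
    have "(matricize A k * ?K) $$ (a, c) = (\<Sum>e<N * P. matricize A k $$ (a, e) * ?K $$ (e, c))"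
      using a c dimK colA by (simp add: matricize_def scalar_prod_def atLeast0LessThan)
    also have "\<dots> = (\<Sum>j<N. \<Sum>p<P. matricize A k $$ (a, j * P + p) * ?K $$ (j * P + p, c))"
      by (rule sum_lessThan_mult)
    also have "\<dots> = (\<Sum>j<N. if j = c div S then
        (\<Sum>p<P. matricize A k $$ (a, j * P + p) * kron_below Y k $$ (p, c mod S)) else 0)"
      by (intro sum.cong refl) (auto simp: K intro!: sum.cong sum.neutral)
    also have "\<dots> = (\<Sum>p<P. matricize A k $$ (a, c div S * P + p) * kron_below Y k $$ (p, c mod S))"
      using h by (simp add: sum.delta)
    also have "\<dots> = (\<Sum>p<P. kron_below Y k $$ (p, c mod S) * tensor_entry A
        (\<lambda>i. if i < k then p div (\<Prod>m<i. dim_row (Y m)) mod dim_row (Y i) else I i))"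
    proof (intro sum.cong refl)
      fix p assume "p \<in> {..<P}"
      then have p: "p < P" by simp
      have "c div S * P + p < Suc (c div S) * P" using p by simp
      also have "\<dots> \<le> N * P" using h by (intro mult_le_mono1) simp
      finally have "matricize A k $$ (a, c div S * P + p) = tensor_entry A (matricize_index A k a (c div S * P + p))"
        using a colA by (simp add: matricize_def)
      then show "matricize A k $$ (a, c div S * P + p) * kron_below Y k $$ (p, c mod S) =
          kron_below Y k $$ (p, c mod S) * tensor_entry A
          (\<lambda>i. if i < k then p div (\<Prod>m<i. dim_row (Y m)) mod dim_row (Y i) else I i)"
        unfolding idx[OF p] by simp
    qed
    also have "\<dots> = tensor_entry ?T I"
      unfolding P_def
    proof (rule initial_mode_product_transpose_entry[symmetric])
      fix i assume i: "i < k"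
      then have "(\<Prod>m<i. dim_col (Y m)) * dim_col (Y i) dvd S"
        unfolding S_def by (rule prod_lessThan_Suc_dvd)
      then show "I i = c mod S div (\<Prod>m<i. dim_col (Y m)) mod dim_col (Y i)"
        using Ilow[OF i] by (simp add: digit_mod)
    qed (use Y S in \<open>simp_all add: S_def[symmetric]\<close>)
    also have "\<dots> = matricize ?T k $$ (a, c)"
      using a c colT by (simp add: matricize_def I_def)
    finally show "matricize ?T k $$ (a, c) = smln_unfolding A Y k $$ (a, c)" by (simp add: unf)
  qed (use dimK colT in \<open>simp_all add: unf matricize_def\<close>)
qed

subsection \<open>The error of the approximant\<close>

lemma L2_set_sum_le: "L2_set (\<lambda>x. \<Sum>k<(d::nat). f k x) A \<le> (\<Sum>k<d. L2_set (f k) A)"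
proof (induction d)
  case (Suc d)
  have "L2_set (\<lambda>x. \<Sum>k<Suc d. f k x) A \<le> L2_set (\<lambda>x. \<Sum>k<d. f k x) A + L2_set (f d) A"
    using L2_set_triangle_ineq[of "\<lambda>x. \<Sum>k<d. f k x" "f d" A] by simp
  with Suc.IH show ?case by simp
qed (simp add: L2_set_def)

text \<open>Consecutive partial products differ only by the factor \<open>P k\<close> in mode
  \<open>k\<close>, so by linearity in that mode their difference is a product with
  \<open>1\<^sub>m (tensor_dim A k) - P k\<close>. The triangle inequality then bounds the
  sum.\<close>

lemma tensor_norm_diff_le_telescope:
  assumes P: "\<And>k. k < d \<Longrightarrow> P k \<in> carrier_mat (tensor_dim A k) (tensor_dim A k)"
    and d: "d \<le> tensor_order A"
  shows "tensor_norm (tensor_diff A (initial_mode_product A P d)) \<le>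
    (\<Sum>k<d. tensor_norm (mode_product (initial_mode_product A P k) k (1\<^sub>m (tensor_dim A k) - P k)))"
proof -
  let ?S = "initial_mode_product A P"
  let ?E = "\<lambda>k. 1\<^sub>m (tensor_dim A k) - P k"
  define f where "f k = tensor_entry (mode_product (?S k) k (?E k))" for k
  have f: "tensor_entry (?S k) I - tensor_entry (?S (Suc k)) I = f k I"
    if k: "k < d" and I: "I \<in> tensor_indices A" for k I
  proof -
    have Ik: "I k < tensor_dim A k" 
      using PiE_mem[OF I[unfolded tensor_indices_def], of k] k d by simp
    have entry: "?E k $$ (I k, j) = (if j = I k then 1 else 0) - P k $$ (I k, j)"
      if "j < tensor_dim A k" for j
      using Ik P[OF k] that by simp
    have "f k I = (\<Sum>j<tensor_dim A k. ?E k $$ (I k, j) * tensor_entry (?S k) (I(k := j)))"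
      by (simp add: f_def tensor_entry_mode_product)
    also have "\<dots> = (\<Sum>j<tensor_dim A k. (if j = I k then tensor_entry (?S k) (I(k := j)) else 0)
        - P k $$ (I k, j) * tensor_entry (?S k) (I(k := j)))"
      by (intro sum.cong refl) (simp add: entry left_diff_distrib del: index_minus_mat)
    also have "\<dots> = tensor_entry (?S k) I - tensor_entry (?S (Suc k)) I"
      using Ik by (simp add: sum_subtractf sum.delta tensor_entry_mode_product)
    finally show ?thesis by simp
  qed
  have "tensor_entry A I - tensor_entry (?S d) I = (\<Sum>k<d. f k I)" if "I \<in> tensor_indices A" for I
    using sum_lessThan_telescope'[of "\<lambda>k. tensor_entry (?S k) I" d] f that by simp
  then have "tensor_norm (tensor_diff A (?S d)) = L2_set (\<lambda>I. \<Sum>k<d. f k I) (tensor_indices A)"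
    by (simp add: tensor_norm_def tensor_diff_def L2_set_def tensor_indices_def)
  also have "\<dots> \<le> (\<Sum>k<d. L2_set (f k) (tensor_indices A))" by (rule L2_set_sum_le)
  also have "\<dots> = (\<Sum>k<d. tensor_norm (mode_product (?S k) k (?E k)))"
  proof (intro sum.cong refl)
    fix k assume "k \<in> {..<d}"
    \<comment> \<open>As the \<open>P i\<close> are square, no dimension changes, and all norms are
      sums over the index set of \<open>A\<close>.\<close>
    then have "tensor_dim (mode_product (?S k) k (?E k)) i = tensor_dim A i" for i
      using P[of i] P[of k] by auto
    then have "tensor_indices (mode_product (?S k) k (?E k)) = tensor_indices A"
      by (simp only: tensor_indices_def tensor_order_mode_product tensor_order_initial_mode_product)
    then show "L2_set (f k) (tensor_indices A) = tensor_norm (mode_product (?S k) k (?E k))"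
      by (simp add: L2_set_def tensor_norm_def f_def)
  qed
  finally show ?thesis .
qed

text \<open>Injectivity of \<open>M * R\<close> passes to the square matrix \<open>R\<close>, which
  is therefore invertible, and then to \<open>M\<close>. The inverse of \<open>R\<close> in the
  pseudoinverse of the product cancels against \<open>R\<close>.\<close>

lemma full_col_rank_sketch_QR:
  assumes M: "M \<in> carrier_mat s r" and R: "R \<in> carrier_mat r r" and rk: "full_col_rank (M * R)"
  shows "pseudo_inverse M \<in> carrier_mat r s" "pseudo_inverse M * M = 1\<^sub>m r"
    "pseudo_inverse (M * R) \<in> carrier_mat r s" "R * pseudo_inverse (M * R) = pseudo_inverse M"
proof -
  have MR: "M * R \<in> carrier_mat s r" using M R by simp
  note inj_MR = full_col_rank_imp_injective[OF MR rk]
  have "v = 0\<^sub>v r" if "v \<in> carrier_vec r" "R *\<^sub>v v = 0\<^sub>v r" for v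
    using that M assoc_mult_mat_vec[OF M R that(1)] by (intro inj_MR) auto
  then obtain S where S: "S \<in> carrier_mat r r" "S * R = 1\<^sub>m r" "R * S = 1\<^sub>m r"
    using real_mat_injective_imp_inverse[OF R] by blast
  have inj: "v = 0\<^sub>v r" if v: "v \<in> carrier_vec r" and 0: "M *\<^sub>v v = 0\<^sub>v s" for v
  proof -
    have Sv: "S *\<^sub>v v \<in> carrier_vec r" using S v by simp
    have RSv: "R *\<^sub>v (S *\<^sub>v v) = v" using assoc_mult_mat_vec[OF R S(1) v] S(3) v by simp
    have "S *\<^sub>v v = 0\<^sub>v r"
      using Sv RSv 0 by (intro inj_MR) (simp_all add: assoc_mult_mat_vec[OF M R Sv])
    then show ?thesis using RSv R by auto
  qed
  have X: "pseudo_inverse M \<in> carrier_mat r s"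
    using pseudo_inverse_of_injective(1)[OF M inj] M by (simp add: is_pseudo_inverse_def)
  then show "pseudo_inverse M \<in> carrier_mat r s" .
  show "pseudo_inverse (M * R) \<in> carrier_mat r s"
    using pseudo_inverse_of_injective(1)[OF MR inj_MR] MR M R by (simp add: is_pseudo_inverse_def)
  show "pseudo_inverse M * M = 1\<^sub>m r" by (rule pseudo_inverse_of_injective(2)[OF M inj])
  have "R * pseudo_inverse (M * R) = R * (S * pseudo_inverse M)"
    using pseudo_inverse_mult_invertible[OF M inj R S] by simp
  also have "\<dots> = pseudo_inverse M" using assoc_mult_mat[OF R S(1) X] S(3) X by simp
  finally show "R * pseudo_inverse (M * R) = pseudo_inverse M" .
qed

text \<open>As \<open>E\<close> annihilates \<open>Q * Q\<^sup>T\<close>, inserting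
  \<open>Qp * Qp\<^sup>T\<close> after \<open>E\<close> changes nothing; the isometry
  \<open>Qp\<close> then drops out of the Frobenius norm.\<close>

lemma frob_norm_oblique_residual_le:
  assumes Q: "Q \<in> carrier_mat n r" and oQ: "orthonormal_cols Q"
    and Qp: "Qp \<in> carrier_mat n s" and compl: "orthonormal_basis_of_complement Qp Q"
    and E: "E \<in> carrier_mat n n" and EQ: "E * Q = 0\<^sub>m n r"
    and B: "B \<in> carrier_mat n m"
  shows "frob_norm (E * B) \<le> frob_norm (Qp\<^sup>T * B) * spectral_norm E"
proof -
  have QT: "Q\<^sup>T \<in> carrier_mat r n" and QpT: "Qp\<^sup>T \<in> carrier_mat s n" using Q Qp by auto
  have QpB: "Qp\<^sup>T * B \<in> carrier_mat s m" using QpT B by simp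
  have proj: "Qp * Qp\<^sup>T = 1\<^sub>m n - Q * Q\<^sup>T"
    by (rule orthonormal_complement_projections[OF Q oQ Qp compl])
  have "E * (Qp * Qp\<^sup>T) = E * 1\<^sub>m n - E * (Q * Q\<^sup>T)"
    unfolding proj using Q by (intro mult_minus_distrib_mat[OF E]) auto
  also have "E * (Q * Q\<^sup>T) = 0\<^sub>m n n" using assoc_mult_mat[OF E Q QT] EQ QT by simp
  also have "E * 1\<^sub>m n - 0\<^sub>m n n = E" using E by (auto intro!: eq_matI)
  finally have "E * B = E * (Qp * Qp\<^sup>T) * B" by simp
  also have "\<dots> = E * (Qp * Qp\<^sup>T * B)" using Qp QpT B by (intro assoc_mult_mat[OF E]) auto
  also have "Qp * Qp\<^sup>T * B = Qp * (Qp\<^sup>T * B)" by (rule assoc_mult_mat[OF Qp QpT B])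
  also have "frob_norm (E * (Qp * (Qp\<^sup>T * B))) \<le> spectral_norm E * frob_norm (Qp * (Qp\<^sup>T * B))"
    using E Qp by (intro frob_norm_mult_le) simp
  also have "frob_norm (Qp * (Qp\<^sup>T * B)) = frob_norm (Qp\<^sup>T * B)"
    using compl Qp by (intro frob_norm_orthonormal_mult) (auto simp: orthonormal_basis_of_complement_def)
  finally show ?thesis by (simp add: mult.commute)
qed

theorem theorem1:
  fixes d :: nat and n r l :: "nat \<Rightarrow> nat"
    and A :: tensor
    and X Y Q R Qp :: "nat \<Rightarrow> real mat"
  assumes "d \<ge> 1"
    and "tensor_order A = d"
    and "\<And>k. k < d \<Longrightarrow> tensor_dim A k = n k"
    and "\<And>k. k < d \<Longrightarrow> 1 \<le> r k \<and> r k \<le> n k"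
    and "\<And>k. k < d \<Longrightarrow>
           X k \<in> carrier_mat ((\<Prod>i<k. r i + l i) * (\<Prod>i \<in> {k<..<d}. n i)) (r k)"
    and "\<And>k. k < d \<Longrightarrow> Y k \<in> carrier_mat (n k) (r k + l k)"
    and "\<And>k. k < d \<Longrightarrow> full_col_rank ((Y k)\<^sup>T * smln_unfolding A Y k * X k)"
    and "\<And>k. k < d \<Longrightarrow> Q k \<in> carrier_mat (n k) (r k) \<and> orthonormal_cols (Q k)"
    and "\<And>k. k < d \<Longrightarrow> R k \<in> carrier_mat (r k) (r k) \<and> upper_triangular (R k)"
    and "\<And>k. k < d \<Longrightarrow> Q k * R k = smln_unfolding A Y k * X k"
    and "\<And>k. k < d \<Longrightarrow> Qp k \<in> carrier_mat (n k) (n k - r k)"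
    and "\<And>k. k < d \<Longrightarrow> orthonormal_basis_of_complement (Qp k) (Q k)"
  shows "tensor_norm (tensor_diff A (smln A X Y)) \<le>
    (\<Sum>k<d. frob_norm ((Qp k)\<^sup>T * smln_unfolding A Y k)
       * spectral_norm (1\<^sub>m (n k) - Q k * pseudo_inverse ((Y k)\<^sup>T * Q k) * (Y k)\<^sup>T)
       * (\<Prod>i<k. spectral_norm (pseudo_inverse ((Y i)\<^sup>T * Q i))))"
proof -
  define C where "C k = pseudo_inverse ((Y k)\<^sup>T * Q k)" for k
  \<comment> \<open>This is the projector without its right factor \<open>(Y k)\<^sup>T\<close>: its
    norm enters the bound, while the transposed sketch is absorbed into the unfolding.\<close>
  define W where "W k = Q k * C k" for k
  define E where "E k = 1\<^sub>m (n k) - W k * (Y k)\<^sup>T" for k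
  let ?B = "smln_unfolding A Y"
  have YT: "(Y k)\<^sup>T \<in> carrier_mat (r k + l k) (n k)" and Q: "Q k \<in> carrier_mat (n k) (r k)"
    and R: "R k \<in> carrier_mat (r k) (r k)" if "k < d" for k
    using assms that by auto
  have B: "?B k \<in> carrier_mat (n k) ((\<Prod>i<k. r i + l i) * (\<Prod>i \<in> {k<..<d}. n i))" if k: "k < d" for k
  proof -
    have "(\<Prod>i<k. dim_col (Y i)) = (\<Prod>i<k. r i + l i)"
      using k carrier_matD(2)[OF assms(6)] by (intro prod.cong) auto
    moreover have "(\<Prod>i\<in>{k<..<d}. tensor_dim A i) = (\<Prod>i\<in>{k<..<d}. n i)"
      using assms(3) by (intro prod.cong) auto
    ultimately show ?thesis using k assms(2,3)
      by (auto simp: smln_unfolding_def matricize_def kronecker_def mult.commute)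
  qed
  have sketch: "(Y k)\<^sup>T * ?B k * X k = (Y k)\<^sup>T * Q k * R k" if k: "k < d" for k
    using assoc_mult_mat[OF YT[OF k] B[OF k] assms(5)[OF k]]
      assoc_mult_mat[OF YT[OF k] Q[OF k] R[OF k]] assms(10)[OF k] by simp
  have C: "C k \<in> carrier_mat (r k) (r k + l k)" and CM: "C k * ((Y k)\<^sup>T * Q k) = 1\<^sub>m (r k)"
    and pinv: "pseudo_inverse ((Y k)\<^sup>T * Q k * R k) \<in> carrier_mat (r k) (r k + l k)"
    and RC: "R k * pseudo_inverse ((Y k)\<^sup>T * Q k * R k) = C k" if k: "k < d" for k
    using full_col_rank_sketch_QR[of "(Y k)\<^sup>T * Q k" "r k + l k" "r k" "R k"]
      YT[OF k] Q[OF k] R[OF k] assms(7)[OF k]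
    unfolding C_def sketch[OF k] by (auto simp: mult_carrier_mat)
  have W: "W k \<in> carrier_mat (n k) (r k + l k)" if "k < d" for k
    using Q[OF that] C[OF that] by (simp add: W_def)
  have proj: "smln_projector A X Y k = W k * (Y k)\<^sup>T" if k: "k < d" for k
    using assoc_mult_mat[OF Q[OF k] R[OF k] pinv[OF k]]
    unfolding smln_projector_def sketch[OF k] assms(10)[OF k, symmetric] W_def RC[OF k] by simp
  have smln: "smln A X Y = initial_mode_product A (\<lambda>k. W k * (Y k)\<^sup>T) d"
    using initial_mode_product_cong[of d "smln_projector A X Y" "\<lambda>k. W k * (Y k)\<^sup>T"] proj assms(2)
    by (simp add: smln_def multi_mode_product_def initial_mode_product_def)
  have WY: "W k * (Y k)\<^sup>T \<in> carrier_mat (n k) (n k)" if "k < d" for k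
    using W[OF that] YT[OF that] by (rule mult_carrier_mat)
  have E: "E k \<in> carrier_mat (n k) (n k)" if "k < d" for k
    unfolding E_def using WY[OF that] by (rule minus_carrier_mat)
  \<comment> \<open>\<open>C k\<close> is a left inverse of \<open>(Y k)\<^sup>T * Q k\<close>, so
    the oblique projector fixes the columns of \<open>Q k\<close>.\<close>
  have EQ: "E k * Q k = 0\<^sub>m (n k) (r k)" if k: "k < d" for k
  proof -
    have "W k * (Y k)\<^sup>T * Q k = W k * ((Y k)\<^sup>T * Q k)"
      by (rule assoc_mult_mat[OF W[OF k] YT[OF k] Q[OF k]])
    also have "\<dots> = Q k * (C k * ((Y k)\<^sup>T * Q k))"
      unfolding W_def using YT[OF k] Q[OF k] by (intro assoc_mult_mat[OF Q[OF k] C[OF k]]) auto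
    also have "\<dots> = Q k" using CM[OF k] Q[OF k] by simp
    finally have WYQ: "W k * (Y k)\<^sup>T * Q k = Q k" .
    have "E k * Q k = 1\<^sub>m (n k) * Q k - W k * (Y k)\<^sup>T * Q k"
      unfolding E_def by (rule minus_mult_distrib_mat[OF one_carrier_mat WY[OF k] Q[OF k]])
    then show ?thesis using WYQ Q[OF k] by simp
  qed
  have "tensor_norm (tensor_diff A (smln A X Y)) \<le> (\<Sum>k<d. tensor_norm
      (mode_product (initial_mode_product A (\<lambda>k. W k * (Y k)\<^sup>T) k) k (1\<^sub>m (tensor_dim A k) - W k * (Y k)\<^sup>T)))"
    unfolding smln using assms(2,3) WY by (intro tensor_norm_diff_le_telescope) auto
  also have "\<dots> \<le> (\<Sum>k<d. frob_norm ((Qp k)\<^sup>T * ?B k) * spectral_norm (E k) * (\<Prod>i<k. spectral_norm (C i)))"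
  proof (rule sum_mono)
    fix k assume "k \<in> {..<d}"
    then have k: "k < d" by simp
    then have i: "i < d" if "i < k" for i using that by simp
    \<comment> \<open>The residual is moved innermost, so that the lower modes are outermost and
      their factors \<open>W i\<close> can be split off.\<close>
    have "tensor_norm (mode_product (initial_mode_product A (\<lambda>k. W k * (Y k)\<^sup>T) k) k (E k))
        = tensor_norm (initial_mode_product (mode_product A k (E k)) (\<lambda>k. W k * (Y k)\<^sup>T) k)"
      by (simp add: initial_mode_product_commute)
    also have "\<dots> \<le> (\<Prod>i<k. spectral_norm (W i))
        * tensor_norm (initial_mode_product (mode_product A k (E k)) (\<lambda>i. (Y i)\<^sup>T) k)"
      using k assms(2,3) carrier_matD[OF W[OF i]] carrier_matD[OF YT[OF i]]
      by (intro tensor_norm_initial_mode_product_mult_le) auto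
    \<comment> \<open>Moved back outermost, \<open>E k\<close> multiplies the mode-\<open>k\<close>
      matricization from the left.\<close>
    also have "initial_mode_product (mode_product A k (E k)) (\<lambda>i. (Y i)\<^sup>T) k
        = mode_product (initial_mode_product A (\<lambda>i. (Y i)\<^sup>T) k) k (E k)"
      by (simp add: initial_mode_product_commute)
    also have "tensor_norm \<dots> = frob_norm (E k * ?B k)"
    proof -
      have "matricize (mode_product (initial_mode_product A (\<lambda>i. (Y i)\<^sup>T) k) k (E k)) k
          = E k * matricize (initial_mode_product A (\<lambda>i. (Y i)\<^sup>T) k) k"
        using k assms(2,3) E[OF k] by (intro matricize_mode_product) auto
      also have "matricize (initial_mode_product A (\<lambda>i. (Y i)\<^sup>T) k) k = ?B k"
        using k assms(2,3) carrier_matD[OF assms(6)] by (intro matricize_initial_mode_product_transpose) auto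
      finally show ?thesis using k assms(2) by (simp add: tensor_norm_eq_frob_norm_matricize[of k])
    qed
    also have "(\<Prod>i<k. spectral_norm (W i)) * frob_norm (E k * ?B k)
        \<le> (\<Prod>i<k. spectral_norm (C i)) * (frob_norm ((Qp k)\<^sup>T * ?B k) * spectral_norm (E k))"
    proof (rule mult_mono)
      have "spectral_norm (W i) \<le> spectral_norm (C i)" if "i < k" for i
        unfolding W_def using assms(8)[OF i[OF that]] C[OF i[OF that]]
        by (intro spectral_norm_orthonormal_mult_le) auto
      then show "(\<Prod>i<k. spectral_norm (W i)) \<le> (\<Prod>i<k. spectral_norm (C i))"
        by (intro prod_mono) auto
      show "frob_norm (E k * ?B k) \<le> frob_norm ((Qp k)\<^sup>T * ?B k) * spectral_norm (E k)"
        using assms(8)[OF k] by (intro frob_norm_oblique_residual_le[OF Q[OF k] _ assms(11)[OF k]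
              assms(12)[OF k] E[OF k] EQ[OF k] B[OF k]]) simp
    qed (simp_all add: prod_nonneg)
    finally show "tensor_norm (mode_product (initial_mode_product A (\<lambda>k. W k * (Y k)\<^sup>T) k) k
          (1\<^sub>m (tensor_dim A k) - W k * (Y k)\<^sup>T))
        \<le> frob_norm ((Qp k)\<^sup>T * ?B k) * spectral_norm (E k) * (\<Prod>i<k. spectral_norm (C i))"
      using assms(3)[OF k] by (simp add: E_def mult.commute)
  qed
  finally show ?thesis by (simp add: E_def W_def C_def)
qed

end
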